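(* Let $n\ge1$, $m\ge 1$, $k\geq 1$, and let $X:S_n\to\mathbb{R}$ be a permutation statistic that is realizable over a constraint set of size $m$. Then $\mathbb{E}_{\lambda}[X^k]$ takes the same value for all partitions $\lambda \vdash n$ all of whose parts have size at least $mk+1$.
   Context: $S_n$ is the symmetric group on $[n]$; for $\lambda\vdash n$, $C_\lambda$ is the conjugacy class of cycle type $\lambda$ and $\mathbb{E}_\lambda$ is expectation under the uniform measure on $C_\lambda$. A (permutation) constraint is a set $K=\{(i_1,j_1),\dots,(i_\ell,j_\ell)\}$ of distinct pairs with $i_t,j_t\in[n]$; its size is the number of pairs it contains. A permutation $\omega\in S_n$ satisfies $K$ if $\omega(i_t)=j_t$ for every $(i_t,j_t)\in K$, and $I_K$ denotes the indicator function of satisfying $K$. The size of a set $\mathcal{C}$ of constraints is the maximum of the sizes of the constraints in $\mathcal{C}$. A statistic $X$ is realizable over $\mathcal{C}$ if $X=\sum_{K\in\mathcal{C}}\mathrm{wt}(K)I_K$ for some weights $\mathrm{wt}(K)\in\mathbb{R}\setminus\{0\}$. *)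

theory Defs
  imports "HOL-Probability.Probability" "HOL-Combinatorics.Orbits"
begin

text \<open>The set \<open>[n]\<close> is \<open>{1..n}\<close>, and the symmetric group is the set of
  functions \<open>\<omega> :: nat \<Rightarrow> nat\<close> with \<open>\<omega> permutes {1..n}\<close> (bijective on \<open>[n]\<close>, identity elsewhere).\<close>

definition symmetric_group :: "nat \<Rightarrow> (nat \<Rightarrow> nat) set" where
  "symmetric_group n = {\<omega>. \<omega> permutes {1..n}}"

definition is_partition :: "nat multiset \<Rightarrow> nat \<Rightarrow> bool" where
  "is_partition lam n \<longleftrightarrow> 0 \<notin># lam \<and> sum_mset lam = n"

text \<open>The image \<open>orbit \<omega> ` {1..n}\<close> is a set, so each cycle contributes its length exactly once;
  fixed points contribute parts equal to 1.\<close>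

definition cycle_type :: "nat \<Rightarrow> (nat \<Rightarrow> nat) \<Rightarrow> nat multiset" where
  "cycle_type n \<omega> = image_mset card (mset_set (orbit \<omega> ` {1..n}))"

definition conj_class :: "nat \<Rightarrow> nat multiset \<Rightarrow> (nat \<Rightarrow> nat) set" where
  "conj_class n lam = {\<omega> \<in> symmetric_group n. cycle_type n \<omega> = lam}"

definition class_expectation :: "nat \<Rightarrow> nat multiset \<Rightarrow> ((nat \<Rightarrow> nat) \<Rightarrow> real) \<Rightarrow> real" where
  "class_expectation n lam Y = measure_pmf.expectation (pmf_of_set (conj_class n lam)) Y"

text \<open>As in the source, a constraint need not be satisfiable: it may contain, for instance,
  both \<open>(1, 1)\<close> and \<open>(1, 2)\<close>. The empty constraint is allowed as well.\<close>

definition is_constraint :: "nat \<Rightarrow> (nat \<times> nat) set \<Rightarrow> bool" where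
  "is_constraint n K \<longleftrightarrow> K \<subseteq> {1..n} \<times> {1..n}"

definition satisfies :: "(nat \<Rightarrow> nat) \<Rightarrow> (nat \<times> nat) set \<Rightarrow> bool" where
  "satisfies \<omega> K \<longleftrightarrow> (\<forall>(i, j) \<in> K. \<omega> i = j)"

definition constraint_indicator :: "(nat \<times> nat) set \<Rightarrow> (nat \<Rightarrow> nat) \<Rightarrow> real" where
  "constraint_indicator K = indicator {\<omega>. satisfies \<omega> K}"

definition is_constraint_set :: "nat \<Rightarrow> (nat \<times> nat) set set \<Rightarrow> bool" where
  "is_constraint_set n C \<longleftrightarrow> (\<forall>K \<in> C. is_constraint n K)"

text \<open>The inserted 0 only serves to give the empty set of constraints the size 0,
  as \<open>Max {}\<close> is unspecified.\<close>

definition constraint_set_size :: "(nat \<times> nat) set set \<Rightarrow> nat" where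
  "constraint_set_size C = Max (insert 0 (card ` C))"

definition realizable_over ::
    "nat \<Rightarrow> ((nat \<Rightarrow> nat) \<Rightarrow> real) \<Rightarrow> (nat \<times> nat) set set \<Rightarrow> bool" where
  "realizable_over n X C \<longleftrightarrow>
     (\<exists>wt :: (nat \<times> nat) set \<Rightarrow> real. (\<forall>K \<in> C. wt K \<noteq> 0) \<and>
        (\<forall>\<omega> \<in> symmetric_group n. X \<omega> = (\<Sum>K \<in> C. wt K * constraint_indicator K \<omega>)))"

end

theory Submission
  imports Defs "HOL-Combinatorics.Cycles"
begin

text \<open>
  Expanding \<open>X ^ k\<close> yields indicators of constraints of size at most \<open>m * k\<close>, so it suffices that
  the probability of satisfying a constraint \<open>K\<close> is the same for all classes whose cycles are
  longer than \<open>card K\<close>. Averaging over conjugation turns this into counting, for a fixed permutation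
  \<open>\<sigma>\<close>, the bijections \<open>g\<close> with \<open>g b = \<sigma> (g a)\<close> for all \<open>(a, b) \<in> K\<close>. The stronger claim that the
  number of those with \<open>g i = x\<close> depends neither on \<open>\<sigma>\<close> nor on \<open>i\<close> and \<open>x\<close> goes by induction on \<open>K\<close>:
  an edge \<open>(i, j)\<close> is contracted while \<open>\<sigma> x\<close> is deleted from its cycle, which shortens the cycles by
  at most one.
\<close>

section \<open>Counting labelings, in total and with one value prescribed\<close>

text \<open>\<open>K\<close> is read as a set of directed edges on \<open>A\<close>, mapped into the
  functional graph of \<open>\<sigma>\<close> on \<open>S\<close>. Source and target are separate
  sets because the induction deletes unrelated points from them, \<open>j\<close> from
  \<open>A\<close> and \<open>\<sigma> x\<close> from \<open>S\<close>. Extensionality makes the set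
  finite, a labeling being determined by its values on \<open>A\<close>.\<close>

definition labelings :: "'a set \<Rightarrow> 'b set \<Rightarrow> ('b \<Rightarrow> 'b) \<Rightarrow> ('a \<times> 'a) set \<Rightarrow> ('a \<Rightarrow> 'b) set" where
  "labelings A S \<sigma> K =
     {g \<in> extensional A. bij_betw g A S \<and> (\<forall>(a, b) \<in> K. g b = \<sigma> (g a))}"

definition pinned_labelings ::
    "'a set \<Rightarrow> 'b set \<Rightarrow> ('b \<Rightarrow> 'b) \<Rightarrow> ('a \<times> 'a) set \<Rightarrow> 'a \<Rightarrow> 'b \<Rightarrow> ('a \<Rightarrow> 'b) set" where
  "pinned_labelings A S \<sigma> K i x = {g \<in> labelings A S \<sigma> K. g i = x}"

text \<open>Iterates restricted to points of \<open>S\<close> suit maps that are only known to be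
  bijective on \<open>S\<close>: after a point is deleted, the map is no longer a permutation of the
  whole type.\<close>

definition cycles_longer_than :: "nat \<Rightarrow> 'b set \<Rightarrow> ('b \<Rightarrow> 'b) \<Rightarrow> bool" where
  "cycles_longer_than l S \<sigma> \<longleftrightarrow> (\<forall>y\<in>S. \<forall>t. 1 \<le> t \<and> t \<le> l \<longrightarrow> (\<sigma> ^^ t) y \<noteq> y)"

lemma finite_labelings:
  assumes "finite A" "finite S"
  shows "finite (labelings A S \<sigma> K)"
proof (rule finite_subset)
  show "labelings A S \<sigma> K \<subseteq> A \<rightarrow>\<^sub>E S"
    by (auto simp: labelings_def PiE_def bij_betw_def)
  show "finite (A \<rightarrow>\<^sub>E S)"
    using assms by (simp add: finite_PiE)
qed

lemma finite_pinned_labelings: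
  assumes "finite A" "finite S"
  shows "finite (pinned_labelings A S \<sigma> K i x)"
  using finite_labelings[OF assms, of \<sigma> K] by (simp add: pinned_labelings_def)

lemma card_labelings_pinned_source:
  assumes "finite A" "finite S" "i \<in> A"
  shows "card (labelings A S \<sigma> K) = (\<Sum>x\<in>S. card (pinned_labelings A S \<sigma> K i x))"
proof -
  have "labelings A S \<sigma> K = (\<Union>x\<in>S. pinned_labelings A S \<sigma> K i x)"
    using assms by (auto simp: labelings_def pinned_labelings_def bij_betw_def)
  moreover have "card (\<Union>x\<in>S. pinned_labelings A S \<sigma> K i x) = (\<Sum>x\<in>S. card (pinned_labelings A S \<sigma> K i x))"
    using assms finite_pinned_labelings[OF assms(1,2)]
    by (intro card_UN_disjoint) (simp_all, auto simp: pinned_labelings_def)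
  ultimately show ?thesis by simp
qed

lemma card_labelings_pinned_target:
  assumes "finite A" "finite S" "x \<in> S"
  shows "card (labelings A S \<sigma> K) = (\<Sum>i\<in>A. card (pinned_labelings A S \<sigma> K i x))"
proof -
  have "labelings A S \<sigma> K = (\<Union>i\<in>A. pinned_labelings A S \<sigma> K i x)"
    using assms by (auto simp: labelings_def pinned_labelings_def bij_betw_def)
  moreover have "card (\<Union>i\<in>A. pinned_labelings A S \<sigma> K i x) = (\<Sum>i\<in>A. card (pinned_labelings A S \<sigma> K i x))"
    using assms finite_pinned_labelings[OF assms(1,2)]
    by (intro card_UN_disjoint)
       (simp_all, auto simp: pinned_labelings_def labelings_def bij_betw_def dest: inj_onD)
  ultimately show ?thesis by simp
qed

text \<open>Precomposing with the transposition of \<open>i\<close> and \<open>u\<close> is an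
  involution that no edge notices, since neither point lies on an edge.\<close>

lemma card_pinned_labelings_swap:
  assumes "i \<in> A" "u \<in> A" "i \<notin> Field K" "u \<notin> Field K"
  shows "card (pinned_labelings A S \<sigma> K i x) = card (pinned_labelings A S \<sigma> K u x)"
proof -
  define T where "T = (\<lambda>g :: 'a \<Rightarrow> 'b. g \<circ> Transposition.transpose i u)"
  have TT: "T (T g) = g" for g
    by (simp add: T_def comp_assoc)
  have sub: "T g \<in> pinned_labelings A S \<sigma> K v x"
    if g: "g \<in> pinned_labelings A S \<sigma> K w x" and vw: "{v, w} = {i, u}" for g v w
  proof -
    have fixed: "Transposition.transpose i u a = a" "Transposition.transpose i u b = b" if "(a, b) \<in> K" for a b
      using that assms by (auto simp: Transposition.transpose_def Field_def)
    have "Transposition.transpose i u permutes A"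
      using assms by (simp add: permutes_swap_id)
    hence "bij_betw (Transposition.transpose i u) A A"
      by (rule permutes_imp_bij)
    hence "bij_betw (T g) A S"
      using g unfolding T_def pinned_labelings_def labelings_def by (auto intro: bij_betw_trans)
    moreover have "T g \<in> extensional A"
      using g assms by (auto simp: T_def pinned_labelings_def labelings_def extensional_def Transposition.transpose_def)
    moreover have "\<forall>(a, b)\<in>K. T g b = \<sigma> (T g a)"
      using g fixed by (auto simp: T_def pinned_labelings_def labelings_def)
    moreover have "T g v = x"
      using g vw by (auto simp: T_def pinned_labelings_def doubleton_eq_iff)
    ultimately show ?thesis by (simp add: pinned_labelings_def labelings_def)
  qed
  have "bij_betw T (pinned_labelings A S \<sigma> K i x) (pinned_labelings A S \<sigma> K u x)"
    by (rule bij_betw_byWitness[where f' = T]) (auto simp: TT intro: sub)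
  thus ?thesis by (rule bij_betw_same_card)
qed

text \<open>The edge forces \<open>g u = \<sigma> (g w)\<close>, and \<open>\<sigma>\<close> is
  injective on \<open>S\<close>. This carries counts from the tail of an edge to its head.\<close>

lemma pinned_labelings_shift:
  assumes "bij_betw \<sigma> S S" "K \<subseteq> A \<times> A" "(w, u) \<in> K" "z \<in> S"
  shows "pinned_labelings A S \<sigma> K u (\<sigma> z) = pinned_labelings A S \<sigma> K w z"
proof -
  have "g u = \<sigma> z \<longleftrightarrow> g w = z" if "g \<in> labelings A S \<sigma> K" for g
  proof -
    have "g w \<in> S" "g u = \<sigma> (g w)"
      using that assms by (auto simp: labelings_def bij_betw_def)
    thus ?thesis
      using assms by (metis bij_betw_inv_into_left)
  qed
  thus ?thesis by (auto simp: pinned_labelings_def)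
qed

section \<open>Deleting a point of a cycle and contracting an edge\<close>

text \<open>The new map jumps over \<open>\<sigma> x\<close>, so \<open>t \<le> l - 1\<close> of its
  steps amount to \<open>t\<close> or \<open>t + 1 \<le> l\<close> steps of \<open>\<sigma>\<close>,
  too few to return to the start.\<close>

lemma cycles_longer_than_skip:
  assumes "cycles_longer_than l S \<sigma>" "bij_betw \<sigma> S S" "x \<in> S"
  shows "cycles_longer_than (l - 1) (S - {\<sigma> x}) (\<sigma>(x := \<sigma> (\<sigma> x)))"
  unfolding cycles_longer_than_def
proof (intro ballI allI impI)
  fix y t assume y: "y \<in> S - {\<sigma> x}" and t: "1 \<le> t \<and> t \<le> l - 1"
  define s where "s = \<sigma>(x := \<sigma> (\<sigma> x))"
  have s: "s x = \<sigma> (\<sigma> x)" "\<And>z. z \<noteq> x \<Longrightarrow> s z = \<sigma> z"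
    by (auto simp: s_def)
  \<comment> \<open>Fewer than \<open>l\<close> steps can skip over \<open>\<sigma> x\<close> at most once.\<close>
  have "r \<le> l - 1 \<Longrightarrow> (s ^^ r) y = (\<sigma> ^^ r) y \<or>
     ((s ^^ r) y = (\<sigma> ^^ Suc r) y \<and> (\<exists>q<r. (\<sigma> ^^ q) y = x))" for r
  proof (induction r)
    case 0
    show ?case by simp
  next
    case (Suc r)
    from Suc.IH Suc.prems consider "(s ^^ r) y = (\<sigma> ^^ r) y"
      | q where "(s ^^ r) y = (\<sigma> ^^ Suc r) y" "q < r" "(\<sigma> ^^ q) y = x" by (metis Suc_leD)
    thus ?case
    proof cases
      case 1
      thus ?thesis by (cases "(\<sigma> ^^ r) y = x") (auto simp: s)
    next
      case 2
      \<comment> \<open>A second jump would require that \<open>x\<close> is reached again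
        \<open>Suc r - q\<close> steps after the first visit, a number between 1 and
        \<open>l\<close>.\<close>
      have "(\<sigma> ^^ (Suc r - q)) x = (\<sigma> ^^ (Suc r - q + q)) y"
        using 2 by (simp only: funpow_add comp_apply)
      also have "\<dots> = (\<sigma> ^^ Suc r) y" using 2 by simp
      finally have "(\<sigma> ^^ (Suc r - q)) x = (\<sigma> ^^ Suc r) y" .
      moreover have "(\<sigma> ^^ (Suc r - q)) x \<noteq> x"
      proof -
        have "1 \<le> Suc r - q" "Suc r - q \<le> l" using 2 Suc.prems by auto
        thus ?thesis using assms(1,3) unfolding cycles_longer_than_def by blast
      qed
      ultimately have "(s ^^ Suc r) y = (\<sigma> ^^ Suc (Suc r)) y"
        using 2 by (auto simp: s)
      thus ?thesis using 2 by (auto intro: less_SucI)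
    qed
  qed
  from this[of t] t have "(s ^^ t) y = (\<sigma> ^^ t) y \<or> (s ^^ t) y = (\<sigma> ^^ Suc t) y" by blast
  moreover have "(\<sigma> ^^ t) y \<noteq> y" "(\<sigma> ^^ Suc t) y \<noteq> y"
    using assms(1) y t unfolding cycles_longer_than_def by (auto simp del: funpow.simps)
  ultimately show "((\<sigma>(x := \<sigma> (\<sigma> x))) ^^ t) y \<noteq> y" unfolding s_def by auto
qed

lemma bij_betw_skip:
  assumes "bij_betw \<sigma> S S" "x \<in> S" "\<sigma> x \<noteq> x"
  shows "bij_betw (\<sigma>(x := \<sigma> (\<sigma> x))) (S - {\<sigma> x}) (S - {\<sigma> x})"
proof (rule bij_betw_imageI)
  have inj: "inj_on \<sigma> S" and im: "\<sigma> ` S = S"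
    using assms by (auto simp: bij_betw_def)
  show "inj_on (\<sigma>(x := \<sigma> (\<sigma> x))) (S - {\<sigma> x})"
    using inj im assms(2,3) by (auto simp: inj_on_def)
  have s: "\<sigma> x \<in> S" using im assms by auto
  show "\<sigma>(x := \<sigma> (\<sigma> x)) ` (S - {\<sigma> x}) = S - {\<sigma> x}"
  proof
    show "\<sigma>(x := \<sigma> (\<sigma> x)) ` (S - {\<sigma> x}) \<subseteq> S - {\<sigma> x}"
      using inj im assms(2,3) s by (auto dest: inj_onD)
    show "S - {\<sigma> x} \<subseteq> \<sigma>(x := \<sigma> (\<sigma> x)) ` (S - {\<sigma> x})"
    proof
      fix y assume y: "y \<in> S - {\<sigma> x}"
      then obtain z where z: "z \<in> S" "y = \<sigma> z" using im by auto
      show "y \<in> \<sigma>(x := \<sigma> (\<sigma> x)) ` (S - {\<sigma> x})"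
      \<comment> \<open>Only \<open>\<sigma> (\<sigma> x)\<close> loses its old preimage; it is now
        hit by \<open>x\<close>.\<close>
      proof (cases "z = \<sigma> x")
        case True
        thus ?thesis using z assms by (intro image_eqI[of _ _ x]) auto
      next
        case False
        thus ?thesis using z y by (intro image_eqI[of _ _ z]) auto
      qed
    qed
  qed
qed

text \<open>Once \<open>g i = x\<close>, the edge forces \<open>g j = \<sigma> x\<close>, so
  \<open>j\<close> and \<open>\<sigma> x\<close> can be removed together. An edge
  \<open>(j, b)\<close> then demands \<open>g b = \<sigma> (\<sigma> x)\<close>, which is an edge
  from \<open>i\<close> for the modified map. By \<open>only\<close>, no other edge leaves
  \<open>i\<close>, where the map has changed, and none enters the removed \<open>j\<close>.\<close>

lemma card_pinned_labelings_contract: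
  assumes K: "K \<subseteq> A \<times> A" "(i, j) \<in> K" "i \<noteq> j"
    and only: "\<And>a b. (a, b) \<in> K - {(i, j)} \<Longrightarrow> a \<noteq> i \<and> b \<noteq> j"
    and \<sigma>: "bij_betw \<sigma> S S" "x \<in> S" "\<sigma> x \<noteq> x"
  shows "card (pinned_labelings A S \<sigma> K i x) =
         card (pinned_labelings (A - {j}) (S - {\<sigma> x}) (\<sigma>(x := \<sigma> (\<sigma> x)))
           (map_prod (id(j := i)) id ` (K - {(i, j)})) i x)"
proof -
  let ?s = "\<sigma>(x := \<sigma> (\<sigma> x))" and ?K = "map_prod (id(j := i)) id ` (K - {(i, j)})"
  let ?P = "pinned_labelings A S \<sigma> K i x"
  let ?Q = "pinned_labelings (A - {j}) (S - {\<sigma> x}) ?s ?K i x"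
  have j: "j \<in> A" "i \<in> A" using K by auto
  have sx: "\<sigma> x \<in> S" using \<sigma> by (auto simp: bij_betw_def)
  have 1: "restrict g (A - {j}) \<in> ?Q \<and> g j = \<sigma> x" if g: "g \<in> ?P" for g
  proof -
    have b: "bij_betw g A S" and gi: "g i = x" and e: "\<And>a b. (a, b) \<in> K \<Longrightarrow> g b = \<sigma> (g a)"
      using g by (auto simp: pinned_labelings_def labelings_def)
    have gj: "g j = \<sigma> x" using e K gi by auto
    have b': "bij_betw g (A - {j}) (S - {\<sigma> x})"
      using bij_betw_DiffI[OF b bij_betw_singletonI[where f = g, OF gj]] j sx by auto
    have step: "restrict g (A - {j}) b = ?s (restrict g (A - {j}) (if a = j then i else a))"
      if ab: "(a, b) \<in> K - {(i, j)}" for a b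
    proof -
      have *: "a \<noteq> i" "b \<noteq> j" "a \<in> A" "b \<in> A" using only[OF ab] ab K(1) by auto
      have **: "g b = \<sigma> (g a)" using e ab by auto
      \<comment> \<open>The modified map differs from \<open>\<sigma>\<close> at \<open>x\<close>
        alone, and only \<open>i\<close> is labeled \<open>x\<close>; so edges not leaving
        \<open>j\<close> keep their meaning.\<close>
      have "g a \<noteq> x"
        using b gi * j by (auto simp: bij_betw_def inj_on_def)
      thus ?thesis using * ** j K gj gi by auto
    qed
    have "\<forall>(a, b) \<in> ?K. restrict g (A - {j}) b = ?s (restrict g (A - {j}) a)"
    proof
      fix e assume "e \<in> ?K"
      then obtain p where p: "p \<in> K - {(i, j)}" "e = map_prod (id(j := i)) id p"
        by (rule imageE)
      obtain a b where "p = (a, b)" by force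
      with p have ab: "(a, b) \<in> K - {(i, j)}" "e = (if a = j then i else a, b)"
        by (simp_all only: map_prod_simp fun_upd_apply id_apply)
      show "case e of (a, b) \<Rightarrow> restrict g (A - {j}) b = ?s (restrict g (A - {j}) a)"
        unfolding ab(2) case_prod_conv by (rule step[OF ab(1)])
    qed
    moreover have "restrict g (A - {j}) i = x" using gi j K by simp
    ultimately show ?thesis
      using gj b'
      by (simp add: pinned_labelings_def labelings_def bij_betw_restrict_eq del: restrict_apply fun_upd_apply ball_simps)
  qed
  have 2: "h(j := \<sigma> x) \<in> ?P" if h: "h \<in> ?Q" for h
  proof -
    have b: "bij_betw h (A - {j}) (S - {\<sigma> x})" and hi: "h i = x"
      and ext: "h \<in> extensional (A - {j})" and edges: "\<forall>(a, b) \<in> ?K. h b = ?s (h a)"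
      using h unfolding pinned_labelings_def labelings_def by blast+
    have e: "h b = ?s (h (if a = j then i else a))" if "(a, b) \<in> K - {(i, j)}" for a b
    proof -
      have "(if a = j then i else a, b) \<in> ?K"
        using that by (intro image_eqI[of _ _ "(a, b)"]) simp_all
      from bspec[OF edges this] show ?thesis by (simp only: case_prod_conv)
    qed
    have "bij_betw (h(j := \<sigma> x)) (A - {j}) (S - {\<sigma> x})"
      using b bij_betw_cong[of "A - {j}" h "h(j := \<sigma> x)"] by auto
    moreover have "bij_betw (h(j := \<sigma> x)) {j} {\<sigma> x}" by simp
    ultimately have "bij_betw (h(j := \<sigma> x)) ((A - {j}) \<union> {j}) ((S - {\<sigma> x}) \<union> {\<sigma> x})"
      by (rule bij_betw_combine) auto
    moreover have "(A - {j}) \<union> {j} = A" "(S - {\<sigma> x}) \<union> {\<sigma> x} = S"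
      using j sx by auto
    ultimately have "bij_betw (h(j := \<sigma> x)) A S" by simp
    moreover have "(h(j := \<sigma> x)) b = \<sigma> ((h(j := \<sigma> x)) a)" if ab: "(a, b) \<in> K" for a b
    proof (cases "(a, b) = (i, j)")
      case True
      thus ?thesis using hi K(3) by simp
    next
      case False
      with ab have ab': "(a, b) \<in> K - {(i, j)}" by blast
      hence *: "a \<noteq> i" "b \<noteq> j" "a \<in> A" "b \<in> A" using only[OF ab'] K(1) by auto
      have "a \<noteq> j \<Longrightarrow> h a \<noteq> x"
        using b hi * j K by (auto simp: bij_betw_def inj_on_def)
      moreover have "h b = ?s (h (if a = j then i else a))" by (rule e[OF ab'])
      ultimately show ?thesis using hi * by (cases "a = j") simp_all
    qed
    moreover have "h(j := \<sigma> x) \<in> extensional A"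
      using ext j by (auto simp: extensional_def)
    moreover have "(h(j := \<sigma> x)) i = x" using hi K(3) by simp
    ultimately show ?thesis unfolding pinned_labelings_def labelings_def by blast
  qed
  have "bij_betw (\<lambda>g. restrict g (A - {j})) ?P ?Q"
  proof (rule bij_betw_byWitness[where f' = "\<lambda>h. h(j := \<sigma> x)"])
    show "\<forall>g\<in>?P. (restrict g (A - {j}))(j := \<sigma> x) = g"
    proof
      fix g assume g: "g \<in> ?P"
      hence "g \<in> extensional A" by (auto simp: pinned_labelings_def labelings_def)
      thus "(restrict g (A - {j}))(j := \<sigma> x) = g"
        using 1[OF g] by (auto simp: fun_eq_iff extensional_def)
    qed
    show "\<forall>h\<in>?Q. restrict (h(j := \<sigma> x)) (A - {j}) = h"
      by (auto simp: pinned_labelings_def labelings_def extensional_def fun_eq_iff)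
  qed (use 1 2 in auto)
  thus ?thesis by (rule bij_betw_same_card)
qed

section \<open>The pinned count depends on \<open>A\<close> and \<open>K\<close> only\<close>

text \<open>Injections between finite sets of equal size are bijections. The factorial is left as a
  product whose factor at 0 is \<open>card A\<close>, from which divisibility by
  \<open>card A\<close> is read off later.\<close>

lemma card_labelings_empty:
  assumes "finite A" "finite S" "card S = card A"
  shows "card (labelings A S \<sigma> {}) = (\<Prod>k<card A. card A - k)"
proof -
  have "labelings A S \<sigma> {} = {g \<in> A \<rightarrow>\<^sub>E S. inj_on g A}"
  proof -
    have "g ` A = S" if "g ` A \<subseteq> S" "inj_on g A" for g
      using assms that by (simp add: card_subset_eq card_image)
    thus ?thesis by (auto simp: labelings_def bij_betw_def PiE_def Pi_iff image_subset_iff)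
  qed
  thus ?thesis
    using card_inj_on_subset_funcset[of A S A] assms by (simp add: atLeast0LessThan)
qed

text \<open>The type argument only fixes the type of the points permuted by \<open>\<sigma>\<close>.\<close>

definition uniform_count :: "'a set \<Rightarrow> ('a \<times> 'a) set \<Rightarrow> 'b itself \<Rightarrow> 'a set \<Rightarrow> nat \<Rightarrow> bool" where
  "uniform_count A K _ I c \<longleftrightarrow>
     (\<forall>(S :: 'b set) \<sigma>. finite S \<and> card S = card A \<and> bij_betw \<sigma> S S \<and>
        cycles_longer_than (card K) S \<sigma> \<longrightarrow>
        (\<forall>i\<in>I. \<forall>x\<in>S. card (pinned_labelings A S \<sigma> K i x) = c))"

text \<open>Contraction handles tails of edges and shifting handles heads. Summing over the possible
  labels compares these counts with the total number of labelings, so they all agree; summing over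
  the possible sources of one label then settles the points that lie on no edge.\<close>

lemma uniform_count_ex:
  fixes A :: "'a set"
  assumes "finite A" "K \<subseteq> A \<times> A"
  shows "\<exists>c. uniform_count A K TYPE('b) A c"
  using assms
proof (induction "card K" arbitrary: A K rule: less_induct)
  case (less K A)
  have finK: "finite K"
    using less.prems by (meson finite_SigmaI finite_subset)
  have edge: "\<exists>c. uniform_count A K TYPE('b) {i} c" if ij: "(i, j) \<in> K" for i j
  proof (cases "i \<noteq> j \<and> (\<forall>(a, b) \<in> K - {(i, j)}. a \<noteq> i \<and> b \<noteq> j)")
    \<comment> \<open>Here no labeling exists. A loop would give a fixed point of
      \<open>\<sigma>\<close>, excluded because \<open>card K \<ge> 1\<close>. Of two edges, a
      common tail forces a common head, and a common head forces a common tail by injectivity of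
      \<open>\<sigma>\<close>.\<close>
    case False
    have "labelings A S \<sigma> K = {}"
      if \<sigma>: "bij_betw \<sigma> S S" "cycles_longer_than (card K) S \<sigma>" for S :: "'b set" and \<sigma>
    proof (rule ccontr)
      assume "labelings A S \<sigma> K \<noteq> {}"
      then obtain g where g: "bij_betw g A S" "\<And>a b. (a, b) \<in> K \<Longrightarrow> g b = \<sigma> (g a)"
        by (auto simp: labelings_def)
      have "1 \<le> card K" using ij finK by (auto simp: Suc_le_eq card_gt_0_iff)
      hence "\<forall>y\<in>S. \<sigma> y \<noteq> y"
        using \<sigma>(2) by (force simp: cycles_longer_than_def dest: spec[of _ 1])
      moreover have gS: "g a \<in> S" if "a \<in> A" for a
        using g(1) that by (auto simp: bij_betw_def)
      ultimately have "i \<noteq> j"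
        using g(2)[OF ij] less.prems ij by (metis mem_Sigma_iff subsetD)
      with False obtain a b where ab: "(a, b) \<in> K" "(a, b) \<noteq> (i, j)" "a = i \<or> b = j"
        by auto
      have inA: "a \<in> A" "b \<in> A" "i \<in> A" "j \<in> A" using ab ij less.prems by auto
      have "a = i \<longleftrightarrow> g a = g i" "b = j \<longleftrightarrow> g b = g j"
        using g(1) inA by (auto simp: bij_betw_def inj_on_def)
      moreover have "g a = g i \<longleftrightarrow> \<sigma> (g a) = \<sigma> (g i)"
        using \<sigma>(1) gS inA by (auto simp: bij_betw_def inj_on_def)
      ultimately show False
        using ab g(2)[OF ij] g(2)[OF ab(1)] by auto
    qed
    hence "uniform_count A K TYPE('b) {i} 0"
      by (auto simp: uniform_count_def pinned_labelings_def)
    thus ?thesis ..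
  next
    case True
    define K' where "K' = map_prod (id(j := i)) id ` (K - {(i, j)})"
    have cK': "card K' \<le> card K - 1"
      unfolding K'_def using finK ij by (metis card_Diff_singleton card_image_le finite_Diff)
    moreover have "card K > 0" using ij finK by (auto simp: card_gt_0_iff)
    ultimately have "card K' < card K" by simp
    moreover have "K' \<subseteq> (A - {j}) \<times> (A - {j})"
      using less.prems ij True by (auto simp: K'_def split: if_splits)
    ultimately obtain c where c: "uniform_count (A - {j}) K' TYPE('b) (A - {j}) c"
      using less.hyps[of K' "A - {j}"] less.prems by auto
    have "card (pinned_labelings A S \<sigma> K i x) = c"
      if S: "finite S" "card S = card A" "bij_betw \<sigma> S S" "cycles_longer_than (card K) S \<sigma>" "x \<in> S"
      for S :: "'b set" and \<sigma> x
    proof -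
      have "\<sigma> x \<noteq> x"
        using S(4,5) \<open>card K > 0\<close> unfolding cycles_longer_than_def
        by (force dest: spec[of _ 1])
      hence "card (pinned_labelings A S \<sigma> K i x) =
          card (pinned_labelings (A - {j}) (S - {\<sigma> x}) (\<sigma>(x := \<sigma> (\<sigma> x))) K' i x)"
        unfolding K'_def using True ij less.prems S
        by (intro card_pinned_labelings_contract) auto
      also have "\<dots> = c"
      proof -
        have "\<sigma> x \<in> S" using S by (auto simp: bij_betw_def)
        \<comment> \<open>The induction balances here: the deleted point lowers the bound on the
          cycles by one, and the contracted edge lowers the number of edges by at least one.\<close>
        moreover have "cycles_longer_than (card K') (S - {\<sigma> x}) (\<sigma>(x := \<sigma> (\<sigma> x)))"
          using cycles_longer_than_skip[OF S(4,3,5)] cK' by (auto simp: cycles_longer_than_def)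
        moreover have "j \<in> A" "i \<in> A - {j}" using ij less.prems True by auto
        ultimately show ?thesis
          using c bij_betw_skip[OF S(3,5) \<open>\<sigma> x \<noteq> x\<close>] S \<open>\<sigma> x \<noteq> x\<close> less.prems
          unfolding uniform_count_def by simp
      qed
      finally show ?thesis .
    qed
    hence "uniform_count A K TYPE('b) {i} c" by (auto simp: uniform_count_def)
    thus ?thesis ..
  qed
  have field: "\<exists>c. uniform_count A K TYPE('b) {u} c" if u: "u \<in> Field K" for u
  proof (cases "u \<in> Domain K")
    case True
    thus ?thesis using edge by auto
  next
    case False
    then obtain w where w: "(w, u) \<in> K" using u by (auto simp: Field_def)
    then obtain c where c: "uniform_count A K TYPE('b) {w} c" using edge by blast
    have "card (pinned_labelings A S \<sigma> K u x) = c"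
      if S: "finite S" "card S = card A" "bij_betw \<sigma> S S" "cycles_longer_than (card K) S \<sigma>" "x \<in> S"
      for S :: "'b set" and \<sigma> x
    proof -
      obtain z where "z \<in> S" "x = \<sigma> z" using S(3,5) by (auto simp: bij_betw_def)
      thus ?thesis
        using pinned_labelings_shift[OF S(3) less.prems(2) w] c S unfolding uniform_count_def
        by auto
    qed
    hence "uniform_count A K TYPE('b) {u} c" by (auto simp: uniform_count_def)
    thus ?thesis ..
  qed
  show ?case
  proof (cases "A = {}")
    case True
    hence "uniform_count A K TYPE('b) A 0" by (simp add: uniform_count_def)
    thus ?thesis ..
  next
    case False
    \<comment> \<open>So far the constants may vary with the vertex. The total count links them: it
      is \<open>card A\<close> times a number that is the same for all \<open>S\<close> and
      \<open>\<sigma>\<close>.\<close>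
    have "\<exists>N. \<forall>(S :: 'b set) \<sigma>. finite S \<and> card S = card A \<and> bij_betw \<sigma> S S \<and>
          cycles_longer_than (card K) S \<sigma> \<longrightarrow> card (labelings A S \<sigma> K) = card A * N"
    proof (cases "K = {}")
      case True
      have "card A dvd (\<Prod>k<card A. card A - k)"
        using dvd_prodI[of "{..<card A}" 0 "\<lambda>k. card A - k"] \<open>A \<noteq> {}\<close> less.prems(1)
        by (simp add: card_gt_0_iff)
      then obtain N where "(\<Prod>k<card A. card A - k) = card A * N" ..
      thus ?thesis
        using True card_labelings_empty[OF less.prems(1)] by (intro exI[of _ N]) auto
    next
      case False
      then obtain i j where "(i, j) \<in> K" by auto
      with edge obtain c where c: "uniform_count A K TYPE('b) {i} c" by blast
      have "card (labelings A S \<sigma> K) = card A * c"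
        if S: "finite S" "card S = card A" "bij_betw \<sigma> S S" "cycles_longer_than (card K) S \<sigma>"
        for S :: "'b set" and \<sigma>
      proof -
        have "i \<in> A" using \<open>(i, j) \<in> K\<close> less.prems by auto
        thus ?thesis
          using card_labelings_pinned_source[OF less.prems(1) S(1) \<open>i \<in> A\<close>, of \<sigma> K] c S
          by (simp add: uniform_count_def)
      qed
      thus ?thesis by blast
    qed
    then obtain N where N: "card (labelings A S \<sigma> K) = card A * N"
      if "finite S" "card S = card A" "bij_betw \<sigma> S S" "cycles_longer_than (card K) S \<sigma>"
      for S :: "'b set" and \<sigma> by blast
    have "card (pinned_labelings A S \<sigma> K i x) = N"
      if S: "finite S" "card S = card A" "bij_betw \<sigma> S S" "cycles_longer_than (card K) S \<sigma>"
        and ix: "i \<in> A" "x \<in> S"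
      for S :: "'b set" and \<sigma> i x
    proof -
      have F: "card (pinned_labelings A S \<sigma> K u x) = N" if u: "u \<in> Field K" for u
      proof -
        obtain c where c: "uniform_count A K TYPE('b) {u} c" using field[OF u] ..
        have "u \<in> A" using u less.prems by (auto simp: Field_def)
        \<comment> \<open>Each of the \<open>card S = card A\<close> labels of \<open>u\<close>
          accounts for \<open>c\<close> labelings, so comparison with the total gives
          \<open>c = N\<close>.\<close>
        hence "card A * N = card A * c"
          using card_labelings_pinned_source[OF less.prems(1) S(1) \<open>u \<in> A\<close>, of \<sigma> K] c S N[OF S]
          by (simp add: uniform_count_def)
        hence "N = c" using \<open>u \<in> A\<close> less.prems by auto
        thus ?thesis using c S ix by (auto simp: uniform_count_def)
      qed
      show ?thesis
      proof (cases "i \<in> Field K")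
        case False
        let ?p = "\<lambda>u. card (pinned_labelings A S \<sigma> K u x)"
        have FA: "Field K \<subseteq> A" using less.prems by (auto simp: Field_def)
        \<comment> \<open>Now the label \<open>x\<close> is fixed and its source varies. Points of
          \<open>Field K\<close> contribute \<open>N\<close> each, and all others contribute the
          same amount as \<open>i\<close> by swapping, so this amount must be \<open>N\<close>
          too.\<close>
        have "card A * N = (\<Sum>u\<in>A. ?p u)"
          using card_labelings_pinned_target[OF less.prems(1) S(1) ix(2)] N[OF S] by simp
        also have "\<dots> = (\<Sum>u\<in>A - Field K. ?p u) + (\<Sum>u\<in>Field K. ?p u)"
          using FA less.prems by (intro sum.subset_diff) auto
        also have "(\<Sum>u\<in>Field K. ?p u) = card (Field K) * N" using F by simp
        also have "(\<Sum>u\<in>A - Field K. ?p u) = (\<Sum>u\<in>A - Field K. ?p i)"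
        proof (rule sum.cong[OF refl])
            fix u assume "u \<in> A - Field K"
            thus "?p u = ?p i" using False ix by (intro card_pinned_labelings_swap) auto
          qed
        also have "\<dots> = card (A - Field K) * ?p i" by simp
        also have "card A = card (A - Field K) + card (Field K)"
          using FA less.prems(1) card_mono[OF less.prems(1) FA] finite_subset[OF FA]
          by (simp add: card_Diff_subset)
        finally have "card (A - Field K) * N = card (A - Field K) * ?p i"
          by (simp add: algebra_simps)
        moreover have "card (A - Field K) \<noteq> 0"
          using False ix less.prems by auto
        ultimately show ?thesis by simp
      qed (rule F)
    qed
    hence "uniform_count A K TYPE('b) A N" unfolding uniform_count_def by blast
    thus ?thesis ..
  qed
qed

section \<open>Permutations of prescribed cycle type\<close>

lemma ex_permutes_full_orbit:
  assumes "finite A"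
  shows "\<exists>\<tau>. \<tau> permutes A \<and> (\<forall>a\<in>A. orbit \<tau> a = A)"
proof -
  obtain cs where cs: "set cs = A" "distinct cs"
    using finite_distinct_list[OF assms] by blast
  let ?\<tau> = "cycle_of_list cs"
  have perm: "?\<tau> permutes A" using cycle_permutes cs by blast
  have "A \<subseteq> orbit ?\<tau> a" if "a \<in> A" for a
  proof
    fix b assume "b \<in> A"
    obtain i j where ij: "i < length cs" "a = cs ! i" "j < length cs" "b = cs ! j"
      using \<open>a \<in> A\<close> \<open>b \<in> A\<close> cs by (metis in_set_conv_nth)
    \<comment> \<open>Rotating by \<open>t\<close> brings position \<open>j\<close> to position
      \<open>i\<close>. Adding the length keeps \<open>t\<close> positive, as an orbit consists of
      the images under at least one application.\<close>
    define t where "t = j + length cs - i"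
    have "(?\<tau> ^^ t) a = map (?\<tau> ^^ t) cs ! i" using ij by simp
    also have "\<dots> = rotate t cs ! i" using cyclic_rotation[OF cs(2)] by simp
    also have "\<dots> = b" using ij by (simp add: nth_rotate t_def)
    finally have "b = (?\<tau> ^^ t) a" ..
    moreover have "t > 0" using ij by (simp add: t_def)
    ultimately show "b \<in> orbit ?\<tau> a" unfolding orbit_altdef by blast
  qed
  with perm permutes_orbit_subset[OF perm] show ?thesis by blast
qed

text \<open>For each part, a full cycle on a block of that size is composed with a permutation of
  the remaining points. This makes the conjugacy classes nonempty, so that their uniform measures
  are meaningful.\<close>

lemma ex_permutes_cycle_lengths:
  assumes "finite S" "sum_mset lam = card S" "0 \<notin># lam"
  shows "\<exists>\<omega>. \<omega> permutes S \<and> image_mset card (mset_set (orbit \<omega> ` S)) = lam"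
  using assms
proof (induction lam arbitrary: S)
  case empty
  thus ?case by (intro exI[of _ id]) (auto simp: permutes_id)
next
  case (add p M)
  from add.prems obtain A where A: "A \<subseteq> S" "card A = p" "finite A"
    by (metis le_add1 obtain_subset_with_card_n sum_mset.add_mset)
  have "card (S - A) = sum_mset M"
    using add.prems A by (simp add: card_Diff_subset)
  then obtain \<omega> where \<omega>: "\<omega> permutes S - A"
      "image_mset card (mset_set (orbit \<omega> ` (S - A))) = M"
    using add.IH[of "S - A"] add.prems by auto
  obtain \<tau> where \<tau>: "\<tau> permutes A" "\<And>a. a \<in> A \<Longrightarrow> orbit \<tau> a = A"
    using ex_permutes_full_orbit[OF A(3)] by blast
  have A1: "orbit (\<tau> \<circ> \<omega>) a = A" if "a \<in> A" for a
  proof -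
    have "orbit \<tau> a = orbit (\<tau> \<circ> \<omega>) a"
      using that permutes_in_image[OF \<tau>(1)] permutes_not_in[OF \<omega>(1)]
      by (intro orbit_cong0[of _ A]) auto
    thus ?thesis using \<tau>(2) that by simp
  qed
  have A2: "orbit (\<tau> \<circ> \<omega>) b = orbit \<omega> b" if "b \<in> S - A" for b
  proof (rule orbit_cong0[of _ "S - A", symmetric])
    show "\<omega> \<in> S - A \<rightarrow> S - A" using permutes_in_image[OF \<omega>(1)] by blast
    show "\<omega> y = (\<tau> \<circ> \<omega>) y" if "y \<in> S - A" for y
      using that permutes_in_image[OF \<omega>(1), of y] permutes_not_in[OF \<tau>(1), of "\<omega> y"] by auto
  qed (rule that)
  have ne: "A \<noteq> {}" using A add.prems by auto
  have "orbit (\<tau> \<circ> \<omega>) ` S = orbit (\<tau> \<circ> \<omega>) ` A \<union> orbit (\<tau> \<circ> \<omega>) ` (S - A)"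
    using A by blast
  also have "\<dots> = insert A (orbit \<omega> ` (S - A))"
    using A1 A2 ne by auto
  finally have img: "orbit (\<tau> \<circ> \<omega>) ` S = insert A (orbit \<omega> ` (S - A))" .
  \<comment> \<open>\<open>mset_set\<close> counts a set once, so the part \<open>p\<close> is
    gained only because \<open>A\<close> is a new orbit.\<close>
  have "A \<notin> orbit \<omega> ` (S - A)"
    using permutes_orbit_subset[OF \<omega>(1)] ne by blast
  hence "image_mset card (mset_set (orbit (\<tau> \<circ> \<omega>) ` S)) = add_mset p M"
    unfolding img using \<omega>(2) A add.prems by simp
  moreover have "\<tau> \<circ> \<omega> permutes S"
    using \<omega>(1) \<tau>(1) A by (intro permutes_compose) (auto intro: permutes_subset)
  ultimately show ?case by blast
qed

lemma conj_class_nonempty: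
  assumes "is_partition lam n"
  shows "conj_class n lam \<noteq> {}"
  using ex_permutes_cycle_lengths[of "{1..n}" lam] assms
  by (auto simp: is_partition_def conj_class_def symmetric_group_def cycle_type_def)

lemma finite_conj_class: "finite (conj_class n lam)"
  by (rule finite_subset[OF _ finite_permutations[of "{1..n}"]])
     (auto simp: conj_class_def symmetric_group_def)

section \<open>Averaging over conjugation\<close>

lemma orbit_conjugate:
  assumes "bij \<pi>"
  shows "orbit (\<pi> \<circ> \<omega> \<circ> inv \<pi>) (\<pi> x) = \<pi> ` orbit \<omega> x"
proof -
  have "((\<pi> \<circ> \<omega> \<circ> inv \<pi>) ^^ t) (\<pi> x) = \<pi> ((\<omega> ^^ t) x)" for t
    using assms by (induction t) (auto simp: bij_is_inj)
  thus ?thesis by (auto simp: orbit_altdef)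
qed

lemma cycle_type_conjugate:
  assumes "\<pi> permutes {1..n}"
  shows "cycle_type n (\<pi> \<circ> \<omega> \<circ> inv \<pi>) = cycle_type n \<omega>"
proof -
  have bij: "bij \<pi>" using assms by (rule permutes_bij)
  have "orbit (\<pi> \<circ> \<omega> \<circ> inv \<pi>) ` {1..n} = (\<lambda>x. orbit (\<pi> \<circ> \<omega> \<circ> inv \<pi>) (\<pi> x)) ` {1..n}"
    using permutes_image[OF assms] by (metis image_image)
  also have "\<dots> = (`) \<pi> ` orbit \<omega> ` {1..n}"
    by (simp add: orbit_conjugate[OF bij] image_image)
  finally have "cycle_type n (\<pi> \<circ> \<omega> \<circ> inv \<pi>) =
      image_mset card (mset_set ((`) \<pi> ` orbit \<omega> ` {1..n}))"
    by (simp add: cycle_type_def)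
  \<comment> \<open>Taking images under a bijection is injective on sets, so distinct orbits stay
    distinct and multiplicities of lengths survive.\<close>
  also have "mset_set ((`) \<pi> ` orbit \<omega> ` {1..n}) = image_mset ((`) \<pi>) (mset_set (orbit \<omega> ` {1..n}))"
    by (intro image_mset_mset_set[symmetric] inj_onI) (simp add: inj_image_eq_iff[OF bij_is_inj[OF bij]])
  also have "image_mset card \<dots> = cycle_type n \<omega>"
  proof -
    have "card (\<pi> ` Y) = card Y" for Y
      using bij by (metis bij_is_inj card_image inj_on_subset subset_UNIV)
    thus ?thesis by (simp add: cycle_type_def multiset.map_comp comp_def)
  qed
  finally show ?thesis .
qed

lemma bij_betw_conjugate_conj_class:
  assumes "\<pi> permutes {1..n}"
  shows "bij_betw (\<lambda>\<omega>. inv \<pi> \<circ> \<omega> \<circ> \<pi>) (conj_class n lam) (conj_class n lam)"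
proof (rule bij_betw_byWitness[where f' = "\<lambda>\<omega>. \<pi> \<circ> \<omega> \<circ> inv \<pi>"])
  have inv: "inv \<pi> permutes {1..n}" "inv (inv \<pi>) = \<pi>"
    using assms by (auto simp: permutes_inv permutes_inv_inv)
  show "\<forall>\<omega>\<in>conj_class n lam. \<pi> \<circ> (inv \<pi> \<circ> \<omega> \<circ> \<pi>) \<circ> inv \<pi> = \<omega>"
    by (simp add: fun_eq_iff permutes_inverses[OF assms])
  show "\<forall>\<omega>\<in>conj_class n lam. inv \<pi> \<circ> (\<pi> \<circ> \<omega> \<circ> inv \<pi>) \<circ> \<pi> = \<omega>"
    by (simp add: fun_eq_iff permutes_inverses[OF assms])
  show "(\<lambda>\<omega>. inv \<pi> \<circ> \<omega> \<circ> \<pi>) ` conj_class n lam \<subseteq> conj_class n lam"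
    using cycle_type_conjugate[OF inv(1)] assms inv
    by (auto simp: conj_class_def symmetric_group_def intro!: permutes_compose)
  show "(\<lambda>\<omega>. \<pi> \<circ> \<omega> \<circ> inv \<pi>) ` conj_class n lam \<subseteq> conj_class n lam"
    using cycle_type_conjugate[OF assms] assms inv
    by (auto simp: conj_class_def symmetric_group_def intro!: permutes_compose)
qed

text \<open>A return to \<open>y\<close> after \<open>t\<close> steps bounds the orbit of
  \<open>y\<close> by \<open>t\<close>, while its size is a part of \<open>lam\<close>.\<close>

lemma cycles_longer_than_conj_class:
  assumes "\<omega> \<in> conj_class n lam" "\<forall>p\<in>#lam. l < p"
  shows "cycles_longer_than l {1..n} \<omega>"
  unfolding cycles_longer_than_def
proof (intro ballI allI impI notI)
  fix y t assume y: "y \<in> {1..n}" and t: "1 \<le> t \<and> t \<le> l" and eq: "(\<omega> ^^ t) y = y"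
  have "card (orbit \<omega> y) \<in># cycle_type n \<omega>"
    using y by (simp add: cycle_type_def)
  hence "l < card (orbit \<omega> y)" using assms by (auto simp: conj_class_def)
  moreover have "orbit \<omega> y = (\<lambda>r. (\<omega> ^^ r) y) ` {..<t}"
    using orbit_altdef_bounded[OF eq] t by auto
  hence "card (orbit \<omega> y) \<le> t"
    using card_image_le[of "{..<t}" "\<lambda>r. (\<omega> ^^ r) y"] by simp
  ultimately show False using t by simp
qed

text \<open>The conjugate sends \<open>a\<close> to \<open>b\<close> exactly if
  \<open>\<pi> b = \<omega> (\<pi> a)\<close>. Permutations and extensional labelings differ only in
  their values outside \<open>{1..n}\<close>, hence the restriction and the extension by the
  identity.\<close>

lemma card_conjugators_satisfying:
  assumes "K \<subseteq> {1..n} \<times> {1..n}"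
  shows "card {\<pi> \<in> symmetric_group n. satisfies (inv \<pi> \<circ> \<omega> \<circ> \<pi>) K} =
         card (labelings {1..n} {1..n} \<omega> K)"
proof -
  let ?A = "{1..n}"
  have sat: "satisfies (inv \<pi> \<circ> \<omega> \<circ> \<pi>) K \<longleftrightarrow> (\<forall>(a, b)\<in>K. \<pi> b = \<omega> (\<pi> a))"
    if "\<pi> permutes ?A" for \<pi>
    using that by (auto simp: satisfies_def permutes_inv_eq)
  have "bij_betw (\<lambda>\<pi>. restrict \<pi> ?A) {\<pi> \<in> symmetric_group n. satisfies (inv \<pi> \<circ> \<omega> \<circ> \<pi>) K}
     (labelings ?A ?A \<omega> K)"
  proof (rule bij_betw_byWitness[where f' = "\<lambda>g a. if a \<in> ?A then g a else a"])
    show "\<forall>\<pi>\<in>{\<pi> \<in> symmetric_group n. satisfies (inv \<pi> \<circ> \<omega> \<circ> \<pi>) K}.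
        (\<lambda>a. if a \<in> ?A then restrict \<pi> ?A a else a) = \<pi>"
      by (auto simp: symmetric_group_def fun_eq_iff permutes_def)
    show "\<forall>g\<in>labelings ?A ?A \<omega> K. restrict (\<lambda>a. if a \<in> ?A then g a else a) ?A = g"
      by (auto simp: labelings_def fun_eq_iff extensional_def)
    show "(\<lambda>\<pi>. restrict \<pi> ?A) ` {\<pi> \<in> symmetric_group n. satisfies (inv \<pi> \<circ> \<omega> \<circ> \<pi>) K}
        \<subseteq> labelings ?A ?A \<omega> K"
    proof safe
      fix \<pi> assume \<pi>: "\<pi> \<in> symmetric_group n" "satisfies (inv \<pi> \<circ> \<omega> \<circ> \<pi>) K"
      have perm: "\<pi> permutes ?A" using \<pi>(1) by (simp add: symmetric_group_def)
      have "restrict \<pi> ?A b = \<omega> (restrict \<pi> ?A a)" if ab: "(a, b) \<in> K" for a b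
      proof -
        have "a \<in> ?A" "b \<in> ?A" using ab assms by auto
        thus ?thesis using \<pi>(2) ab unfolding sat[OF perm] by auto
      qed
      moreover have "bij_betw (restrict \<pi> ?A) ?A ?A"
        using permutes_imp_bij[OF perm] by (simp only: bij_betw_restrict_eq)
      ultimately show "restrict \<pi> ?A \<in> labelings ?A ?A \<omega> K"
        unfolding labelings_def using restrict_extensional by blast
    qed
    show "(\<lambda>g a. if a \<in> ?A then g a else a) ` labelings ?A ?A \<omega> K
        \<subseteq> {\<pi> \<in> symmetric_group n. satisfies (inv \<pi> \<circ> \<omega> \<circ> \<pi>) K}"
    proof safe
      fix g assume g: "g \<in> labelings ?A ?A \<omega> K"
      let ?h = "\<lambda>a. if a \<in> ?A then g a else a"
      have "bij_betw ?h ?A ?A \<longleftrightarrow> bij_betw g ?A ?A" by (rule bij_betw_cong) simp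
      hence "bij_betw ?h ?A ?A" using g by (simp add: labelings_def)
      hence h: "?h permutes ?A" by (rule bij_imp_permutes) auto
      thus "?h \<in> symmetric_group n" by (simp add: symmetric_group_def)
      show "satisfies (inv ?h \<circ> \<omega> \<circ> ?h) K"
      proof (subst sat[OF h], safe)
        fix a b assume ab: "(a, b) \<in> K"
        hence "a \<in> ?A" "b \<in> ?A" using assms by auto
        thus "?h b = \<omega> (?h a)" using g ab by (auto simp: labelings_def)
      qed
    qed
  qed
  thus ?thesis by (rule bij_betw_same_card)
qed

lemma card_Collect_bij_betw:
  assumes "bij_betw f A B"
  shows "card {x \<in> A. P (f x)} = card {y \<in> B. P y}"
proof (rule bij_betw_same_card)
  show "bij_betw f {x \<in> A. P (f x)} {y \<in> B. P y}"
    using assms by (auto simp: bij_betw_def inj_on_def)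
qed

text \<open>Pairs of a conjugator and a class member whose conjugate satisfies \<open>K\<close> are
  counted twice. Each conjugator sees the same number of members, and each member admits
  \<open>n * c\<close> conjugators, one \<open>c\<close> for each label of the point 1. Stated as a
  product, the claim also covers empty classes.\<close>

lemma card_satisfying_conj_class:
  assumes "K \<subseteq> {1..n} \<times> {1..n}"
  shows "\<exists>c::real. \<forall>lam. (\<forall>p\<in>#lam. card K < p) \<longrightarrow>
    real (card {\<omega> \<in> conj_class n lam. satisfies \<omega> K}) = c * real (card (conj_class n lam))"
proof (cases "n = 0")
  case True
  \<comment> \<open>Without points there is no point 1 to pin; the only constraint is empty and
    always satisfied.\<close>
  hence "K = {}" using assms by auto
  thus ?thesis by (auto simp: satisfies_def)
next
  case False
  let ?A = "{1..n}" and ?P = "symmetric_group n"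
  obtain c where c: "uniform_count ?A K TYPE(nat) ?A c"
    using uniform_count_ex[of ?A K] assms by auto
  have finP: "finite ?P" using finite_permutations[of ?A] by (simp add: symmetric_group_def)
  have cardP: "card ?P = fact n"
    using card_permutations[of ?A n] by (simp add: symmetric_group_def)
  have "real (card {\<omega> \<in> conj_class n lam. satisfies \<omega> K}) =
      real (n * c) / fact n * real (card (conj_class n lam))"
    if lam: "\<forall>p\<in>#lam. card K < p" for lam
  proof -
    let ?C = "conj_class n lam"
    let ?sat = "\<lambda>\<pi> \<omega>. satisfies (inv \<pi> \<circ> \<omega> \<circ> \<pi>) K"
    have "card {\<omega> \<in> ?C. ?sat \<pi> \<omega>} = card {\<omega> \<in> ?C. satisfies \<omega> K}" if "\<pi> \<in> ?P" for \<pi>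
    proof -
      have b: "bij_betw (\<lambda>\<omega>. inv \<pi> \<circ> \<omega> \<circ> \<pi>) ?C ?C"
        using that bij_betw_conjugate_conj_class by (auto simp: symmetric_group_def)
      show ?thesis using card_Collect_bij_betw[OF b, of "\<lambda>\<omega>. satisfies \<omega> K"] .
    qed
    hence "fact n * card {\<omega> \<in> ?C. satisfies \<omega> K} = (\<Sum>\<pi>\<in>?P. card {\<omega> \<in> ?C. ?sat \<pi> \<omega>})"
      by (simp add: cardP)
    also have "\<dots> = (\<Sum>\<omega>\<in>?C. card {\<pi> \<in> ?P. ?sat \<pi> \<omega>})"
      using finP finite_conj_class[of n lam] by (intro sum_multicount_gen) simp_all
    also have "\<dots> = (\<Sum>\<omega>\<in>?C. n * c)"
    proof (rule sum.cong)
      fix \<omega> assume \<omega>: "\<omega> \<in> ?C"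
      hence "bij_betw \<omega> ?A ?A"
        by (auto simp: conj_class_def symmetric_group_def permutes_imp_bij)
      moreover have "cycles_longer_than (card K) ?A \<omega>"
        using cycles_longer_than_conj_class[OF \<omega>] lam by blast
      ultimately have "card (pinned_labelings ?A ?A \<omega> K 1 x) = c" if "x \<in> ?A" for x
        using c that False by (auto simp: uniform_count_def)
      thus "card {\<pi> \<in> ?P. ?sat \<pi> \<omega>} = n * c"
        using card_labelings_pinned_source[of ?A ?A 1 \<omega> K] False
        by (simp add: card_conjugators_satisfying[OF assms])
    qed simp
    finally have "fact n * card {\<omega> \<in> ?C. satisfies \<omega> K} = card ?C * (n * c)" by simp
    hence "real (fact n * card {\<omega> \<in> ?C. satisfies \<omega> K}) = real (card ?C * (n * c))" by simp
    thus ?thesis by (simp add: field_simps)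
  qed
  thus ?thesis by blast
qed

section \<open>Moments of realizable statistics\<close>

text \<open>The extra indicator of \<open>L\<close> collects the constraints already multiplied out.
  Expanding one factor \<open>X\<close> replaces \<open>L\<close> by \<open>K \<union> L\<close>, at
  most \<open>m\<close> pairs larger, while \<open>k\<close> drops by one; hence the fixed bound
  \<open>s\<close> on \<open>card L + m * k\<close> survives.\<close>

lemma sum_power_conj_class:
  assumes C: "is_constraint_set n C" "\<And>K. K \<in> C \<Longrightarrow> card K \<le> m"
    and X: "\<And>\<omega>. \<omega> \<in> symmetric_group n \<Longrightarrow> X \<omega> = (\<Sum>K\<in>C. wt K * constraint_indicator K \<omega>)"
    and L: "L \<subseteq> {1..n} \<times> {1..n}" "card L + m * k \<le> s"
  shows "\<exists>c. \<forall>lam. (\<forall>p\<in>#lam. s < p) \<longrightarrow>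
    (\<Sum>\<omega>\<in>conj_class n lam. X \<omega> ^ k * constraint_indicator L \<omega>) = c * real (card (conj_class n lam))"
  using L
proof (induction k arbitrary: L)
  case 0
  obtain c where c: "\<And>lam. (\<forall>p\<in>#lam. card L < p) \<Longrightarrow>
      real (card {\<omega> \<in> conj_class n lam. satisfies \<omega> L}) = c * real (card (conj_class n lam))"
    using card_satisfying_conj_class[OF 0(1)] by blast
  have "(\<Sum>\<omega>\<in>conj_class n lam. constraint_indicator L \<omega>) = c * real (card (conj_class n lam))"
    if "\<forall>p\<in>#lam. s < p" for lam
  proof -
    have "\<forall>p\<in>#lam. card L < p" using that 0(2) by auto
    moreover have "conj_class n lam \<inter> {\<omega>. satisfies \<omega> L} = {\<omega> \<in> conj_class n lam. satisfies \<omega> L}"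
      by auto
    ultimately show ?thesis
      using c finite_conj_class[of n lam] by (simp add: constraint_indicator_def sum.If_cases indicator_def)
  qed
  thus ?case by auto
next
  case (Suc k)
  have "\<exists>c. \<forall>lam. (\<forall>p\<in>#lam. s < p) \<longrightarrow>
      (\<Sum>\<omega>\<in>conj_class n lam. X \<omega> ^ k * constraint_indicator (K \<union> L) \<omega>) =
        c * real (card (conj_class n lam))" if "K \<in> C" for K
  proof (rule Suc.IH)
    show "K \<union> L \<subseteq> {1..n} \<times> {1..n}"
      using Suc.prems C that by (auto simp: is_constraint_set_def is_constraint_def)
    show "card (K \<union> L) + m * k \<le> s"
      using card_Un_le[of K L] C(2)[OF that] Suc.prems by simp
  qed
  \<comment> \<open>One constant is chosen for each \<open>K\<close>, independent of
    \<open>lam\<close>, so the weighted sum of these constants is again independent of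
    \<open>lam\<close>.\<close>
  then obtain c where c: "\<And>K lam. K \<in> C \<Longrightarrow> (\<forall>p\<in>#lam. s < p) \<Longrightarrow>
      (\<Sum>\<omega>\<in>conj_class n lam. X \<omega> ^ k * constraint_indicator (K \<union> L) \<omega>) =
        c K * real (card (conj_class n lam))"
    by metis
  have "(\<Sum>\<omega>\<in>conj_class n lam. X \<omega> ^ Suc k * constraint_indicator L \<omega>) =
      (\<Sum>K\<in>C. wt K * c K) * real (card (conj_class n lam))"
    if lam: "\<forall>p\<in>#lam. s < p" for lam
  proof -
    have "X \<omega> ^ Suc k * constraint_indicator L \<omega> =
        (\<Sum>K\<in>C. wt K * (X \<omega> ^ k * constraint_indicator (K \<union> L) \<omega>))"
      if "\<omega> \<in> conj_class n lam" for \<omega>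
    proof -
      have "constraint_indicator (K \<union> L) \<omega> = constraint_indicator K \<omega> * constraint_indicator L \<omega>" for K
        by (simp add: constraint_indicator_def satisfies_def indicator_def ball_Un)
      note Un = this
      have "X \<omega> = (\<Sum>K\<in>C. wt K * constraint_indicator K \<omega>)"
        using X that by (simp add: conj_class_def)
      hence "X \<omega> ^ Suc k * constraint_indicator L \<omega> =
          (\<Sum>K\<in>C. wt K * constraint_indicator K \<omega>) * (X \<omega> ^ k * constraint_indicator L \<omega>)"
        by (simp only: power_Suc mult_ac)
      also have "\<dots> = (\<Sum>K\<in>C. wt K * (X \<omega> ^ k * constraint_indicator (K \<union> L) \<omega>))"
        unfolding sum_distrib_right Un by (simp only: mult_ac)
      finally show ?thesis .
    qed
    hence "(\<Sum>\<omega>\<in>conj_class n lam. X \<omega> ^ Suc k * constraint_indicator L \<omega>) =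
        (\<Sum>\<omega>\<in>conj_class n lam. \<Sum>K\<in>C. wt K * (X \<omega> ^ k * constraint_indicator (K \<union> L) \<omega>))"
      by (rule sum.cong[OF refl])
    also have "\<dots> = (\<Sum>K\<in>C. wt K *
        (\<Sum>\<omega>\<in>conj_class n lam. X \<omega> ^ k * constraint_indicator (K \<union> L) \<omega>))"
      by (subst sum.swap) (simp add: sum_distrib_left)
    also have "\<dots> = (\<Sum>K\<in>C. wt K * c K) * real (card (conj_class n lam))"
      using c lam by (simp add: sum_distrib_right mult.assoc)
    finally show ?thesis .
  qed
  thus ?case by blast
qed

theorem theorem1p3:
  fixes n m k :: nat
    and X :: "(nat \<Rightarrow> nat) \<Rightarrow> real"
    and C :: "(nat \<times> nat) set set"
  assumes "n \<ge> 1" and "m \<ge> 1" and "k \<ge> 1"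
    and "is_constraint_set n C" and "constraint_set_size C = m"
    and "realizable_over n X C"
  shows "\<exists>c. \<forall>lam. is_partition lam n \<and> (\<forall>p \<in># lam. p \<ge> m * k + 1) \<longrightarrow>
           class_expectation n lam (\<lambda>\<omega>. X \<omega> ^ k) = c"
proof -
  \<comment> \<open>Finiteness of \<open>C\<close> makes the \<open>Max\<close> in
    \<open>constraint_set_size\<close> a genuine upper bound.\<close>
  have "C \<subseteq> Pow ({1..n} \<times> {1..n})"
    using assms(4) by (auto simp: is_constraint_set_def is_constraint_def)
  hence "finite C" by (rule finite_subset) simp
  hence size: "card K \<le> m" if "K \<in> C" for K
    using that assms(5) by (auto simp: constraint_set_size_def)
  obtain wt where "\<And>\<omega>. \<omega> \<in> symmetric_group n \<Longrightarrow>
      X \<omega> = (\<Sum>K\<in>C. wt K * constraint_indicator K \<omega>)"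
    using assms(6) by (auto simp: realizable_over_def)
  \<comment> \<open>The expansion starts from the empty constraint, whose indicator is constantly
    1.\<close>
  from sum_power_conj_class[OF assms(4) size this, of "{}" k "m * k"]
  obtain c where c: "\<And>lam. (\<forall>p\<in>#lam. m * k < p) \<Longrightarrow>
      (\<Sum>\<omega>\<in>conj_class n lam. X \<omega> ^ k) = c * real (card (conj_class n lam))"
    by (auto simp: constraint_indicator_def satisfies_def)
  have "class_expectation n lam (\<lambda>\<omega>. X \<omega> ^ k) = c"
    if "is_partition lam n" "\<forall>p \<in># lam. p \<ge> m * k + 1" for lam
  proof -
    note C = conj_class_nonempty[OF that(1)] finite_conj_class[of n lam]
    have "class_expectation n lam (\<lambda>\<omega>. X \<omega> ^ k) =
        (\<Sum>\<omega>\<in>conj_class n lam. X \<omega> ^ k) / card (conj_class n lam)"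
      unfolding class_expectation_def by (rule integral_pmf_of_set[OF C])
    also have "(\<Sum>\<omega>\<in>conj_class n lam. X \<omega> ^ k) = c * real (card (conj_class n lam))"
      using that(2) by (intro c) auto
    also have "\<dots> / card (conj_class n lam) = c" using C by simp
    finally show ?thesis .
  qed
  thus ?thesis by blast
qed

end
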